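(* Let $\mathcal{K}$ be a unital associative algebra over $\mathbb{C}$ (not necessarily commutative), and let $A$ and $B$ be Manin matrices over $\mathcal{K}$ of sizes $n\times k$ and $k\times n$ respectively, with pairwise commuting entries: $[A_{ij},B_{pq}]=0$ for all $i,j,p,q$. Then $$\det{}^{col}(1_{n\times n}-AB)=\det{}^{col}(1_{k\times k}-BA).$$
   Context: A (possibly rectangular) matrix $M=(M_{ij})$ with entries in an associative ring $\mathcal{K}$ is called a Manin matrix if (1) entries lying in the same column commute with each other, and (2) $[M_{ij},M_{kl}]=[M_{kj},M_{il}]$ for all $i,j,k,l$, where $[a,b]=ab-ba$. For any $n\times n$ matrix $X$ over $\mathcal{K}$, $\det^{col}(X)=\sum_{\sigma\in S_n}\operatorname{sgn}(\sigma)\,X_{\sigma(1)1}X_{\sigma(2)2}\cdots X_{\sigma(n)n}$. *)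

theory Defs
  imports Complex_Main "HOL-Combinatorics.Permutations" "Jordan_Normal_Form.Matrix"
begin

text \<open>
  The sort \<open>{ring, monoid_mult}\<close> is that of unital associative rings; unlike \<open>ring_1\<close> it does not
  exclude the zero ring.
\<close>

locale complex_unital_algebra = vector_space scale
  for scale :: "complex \<Rightarrow> 'a::{ring,monoid_mult} \<Rightarrow> 'a" +
  assumes scale_mult_left: "scale c x * y = scale c (x * y)"
    and scale_mult_right: "x * scale c y = scale c (x * y)"

definition ring_commutator :: "'a::ring \<Rightarrow> 'a \<Rightarrow> 'a" where
  "ring_commutator a b = a * b - b * a"

definition manin_matrix :: "'a::ring mat \<Rightarrow> bool" where
  "manin_matrix M \<longleftrightarrow>
     (\<forall>i<dim_row M. \<forall>k<dim_row M. \<forall>j<dim_col M.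
        ring_commutator (M $$ (i, j)) (M $$ (k, j)) = 0) \<and>
     (\<forall>i<dim_row M. \<forall>k<dim_row M. \<forall>j<dim_col M. \<forall>l<dim_col M.
        ring_commutator (M $$ (i, j)) (M $$ (k, l)) =
        ring_commutator (M $$ (k, j)) (M $$ (i, l)))"

text \<open>
  The factors do not commute, so the product is taken over the list of columns in increasing order.
  The sign is a case distinction because \<open>of_int (sign \<sigma>)\<close> would need \<open>ring_1\<close>. As for the library's
  determinant, the value on non-square matrices is \<open>0\<close> by convention.
\<close>

definition det_col :: "'a::{ring,monoid_mult} mat \<Rightarrow> 'a" where
  "det_col X =
     (if dim_row X = dim_col X
      then \<Sum>\<sigma> | \<sigma> permutes {0..<dim_col X}.
             (if evenperm \<sigma> then 1 else - 1) *
             prod_list (map (\<lambda>j. X $$ (\<sigma> j, j)) [0..<dim_col X])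
      else 0)"

end

theory Submission
  imports Defs
begin

text \<open>
  Expanding the columns of \<open>1 - AB\<close> gives the alternating sum of the principal minors of \<open>AB\<close>. By the
  Manin condition on \<open>A\<close>, column determinants of \<open>A\<close> are alternating in the columns, so the
  Cauchy-Binet formula holds and the principal minor of \<open>AB\<close> on \<open>I\<close> is the sum over \<open>J\<close> of the
  \<open>(I, J)\<close> minor of \<open>A\<close> times the \<open>(J, I)\<close> minor of \<open>B\<close>. The two factors commute, so the result is
  symmetric in \<open>A\<close> and \<open>B\<close>. Instead of subsets of size \<open>m\<close>, rows and columns are selected by
  arbitrary functions on \<open>{0..<m}\<close>; this counts each subset \<open>m!\<close> times (noninjective selections
  contribute \<open>0\<close>), and \<open>m!\<close> is invertible over the complex numbers.
\<close>

section \<open>Ordered products in a noncommutative ring\<close>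

lemma mult_prod_list_commute:
  fixes x :: "'a::monoid_mult"
  assumes "\<And>y. y \<in> set ys \<Longrightarrow> x * y = y * x"
  shows "x * prod_list ys = prod_list ys * x"
  using assms
proof (induction ys)
  case (Cons y ys)
  have "x * prod_list (y # ys) = y * (x * prod_list ys)"
    using Cons.prems[of y] by (simp flip: mult.assoc)
  also have "\<dots> = prod_list (y # ys) * x"
    using Cons by (simp add: mult.assoc)
  finally show ?case .
qed simp

lemma prod_list_commute:
  fixes xs :: "'a::monoid_mult list"
  assumes "\<And>x y. x \<in> set xs \<Longrightarrow> y \<in> set ys \<Longrightarrow> x * y = y * x"
  shows "prod_list xs * prod_list ys = prod_list ys * prod_list xs"
  by (intro mult_prod_list_commute sym[OF mult_prod_list_commute] assms sym[OF assms])

lemma prod_list_map_mult_commuting: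
  fixes F G :: "'b \<Rightarrow> 'a::monoid_mult"
  assumes "\<And>x y. x \<in> set js \<Longrightarrow> y \<in> set js \<Longrightarrow> F x * G y = G y * F x"
  shows "prod_list (map (\<lambda>j. F j * G j) js) = prod_list (map F js) * prod_list (map G js)"
  using assms
proof (induction js)
  case (Cons a js)
  have "G a * prod_list (map F js) = prod_list (map F js) * G a"
    using Cons.prems by (intro mult_prod_list_commute) auto
  then have "F a * (G a * (prod_list (map F js) * P)) = F a * (prod_list (map F js) * (G a * P))" for P
    by (metis mult.assoc)
  moreover have "prod_list (map (\<lambda>j. F j * G j) js) = prod_list (map F js) * prod_list (map G js)"
    using Cons by simp
  ultimately show ?case by (simp add: mult.assoc)
qed simp

lemma prod_list_map_sum:
  fixes F :: "'b \<Rightarrow> 'c \<Rightarrow> 'a::{ring,monoid_mult}"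
  assumes "distinct js" and "finite S"
  shows "prod_list (map (\<lambda>j. \<Sum>l\<in>S. F j l) js) =
    (\<Sum>f\<in>set js \<rightarrow>\<^sub>E S. prod_list (map (\<lambda>j. F j (f j)) js))"
  using assms(1)
proof (induction js)
  case (Cons a js)
  have "(\<Sum>f\<in>set (a # js) \<rightarrow>\<^sub>E S. prod_list (map (\<lambda>j. F j (f j)) (a # js))) =
    (\<Sum>(l, f)\<in>S \<times> (set js \<rightarrow>\<^sub>E S). prod_list (map (\<lambda>j. F j ((f(a := l)) j)) (a # js)))"
    unfolding list.set PiE_insert_eq using Cons.prems
    by (subst sum.reindex[OF inj_combinator]) (auto simp: case_prod_unfold)
  also have "\<dots> = (\<Sum>(l, f)\<in>S \<times> (set js \<rightarrow>\<^sub>E S). F a l * prod_list (map (\<lambda>j. F j (f j)) js))"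
  proof -
    have "map (\<lambda>j. F j ((f(a := l)) j)) js = map (\<lambda>j. F j (f j)) js" for f l
      using Cons.prems by (auto intro!: map_cong)
    then show ?thesis by (simp only: list.map prod_list.Cons fun_upd_same)
  qed
  also have "\<dots> = (\<Sum>l\<in>S. F a l) * (\<Sum>f\<in>set js \<rightarrow>\<^sub>E S. prod_list (map (\<lambda>j. F j (f j)) js))"
    by (simp add: sum_product sum.cartesian_product)
  finally show ?case using Cons by simp
qed simp

text \<open>\<open>I\<close> collects the positions at which \<open>- F j\<close> is chosen;
  everywhere else the 0/1 term is chosen and survives only if \<open>P j\<close>. Signs and 0/1
  terms are central, so the chosen \<open>F j\<close> keep their order in \<open>js\<close>.\<close>

lemma prod_list_map_delta_diff:
  fixes F :: "'b \<Rightarrow> 'a::{ring,monoid_mult}"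
  assumes "distinct js"
  shows "prod_list (map (\<lambda>j. (if P j then 1 else 0) - F j) js) =
    (\<Sum>I\<in>Pow (set js). if \<forall>j\<in>set js - I. P j
       then (- 1) ^ card I * prod_list (map F (filter (\<lambda>j. j \<in> I) js)) else 0)"
  using assms
proof (induction js)
  case (Cons a js)
  let ?t = "\<lambda>js I. if \<forall>j\<in>set js - I. P j
       then (- 1) ^ card I * prod_list (map F (filter (\<lambda>j. j \<in> I) js)) else 0"
  have comm: "F a * (- 1) ^ n = (- 1) ^ n * F a" for n
    by (induction n) (simp_all add: mult.assoc)
  \<comment> \<open>Subsets without \<open>a\<close> take the 0/1 term of the first factor, subsets
    with \<open>a\<close> take \<open>- F a\<close>.\<close>
  have "(\<Sum>I\<in>Pow (set (a # js)). ?t (a # js) I) =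
    (\<Sum>I\<in>Pow (set js). ?t (a # js) I) + (\<Sum>I\<in>Pow (set js). ?t (a # js) (insert a I))"
  proof -
    have "inj_on (insert a) (Pow (set js))"
      using Cons.prems by (auto simp: inj_on_def)
    moreover have "Pow (set js) \<inter> insert a ` Pow (set js) = {}"
      using Cons.prems by auto
    ultimately show ?thesis
      unfolding list.set(2) Pow_insert
      by (subst sum.union_disjoint) (simp_all only: sum.reindex o_def finite_Pow_iff finite_imageI List.finite_set)
  qed
  also have "(\<Sum>I\<in>Pow (set js). ?t (a # js) I) = (\<Sum>I\<in>Pow (set js). (if P a then 1 else 0) * ?t js I)"
    using Cons.prems by (intro sum.cong) (auto intro!: arg_cong[where f=prod_list])
  also have "(\<Sum>I\<in>Pow (set js). ?t (a # js) (insert a I)) = (\<Sum>I\<in>Pow (set js). - (F a * ?t js I))"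
  proof (intro sum.cong refl)
    fix I assume I: "I \<in> Pow (set js)"
    then have "finite I" "a \<notin> I" using Cons.prems by (auto intro: finite_subset)
    moreover have "filter (\<lambda>j. j = a \<or> j \<in> I) js = filter (\<lambda>j. j \<in> I) js"
      using Cons.prems by (intro filter_cong) auto
    moreover have "(\<forall>j\<in>insert a (set js) - insert a I. P j) \<longleftrightarrow> (\<forall>j\<in>set js - I. P j)"
      using Cons.prems by auto
    ultimately show "?t (a # js) (insert a I) = - (F a * ?t js I)"
      using comm[of "card I"] by (simp add: mult.assoc[symmetric])
  qed
  finally show ?case
    using Cons by (simp add: sum_distrib_left[symmetric] sum_negf left_diff_distrib)
qed simp

section \<open>Signs and noncommutative minors\<close>

definition psign :: "('b \<Rightarrow> 'b) \<Rightarrow> 'a::{ring,monoid_mult}" where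
  "psign \<sigma> = (if evenperm \<sigma> then 1 else - 1)"

lemma psign_compose:
  "permutation p \<Longrightarrow> permutation q \<Longrightarrow> psign (p \<circ> q) = (psign p * psign q :: 'a::{ring,monoid_mult})"
  by (simp add: psign_def evenperm_comp)

lemma psign_commute: "(x :: 'a::{ring,monoid_mult}) * psign p = psign p * x"
  by (simp add: psign_def)

lemma psign_mult_self: "psign p * (psign p * x) = (x :: 'a::{ring,monoid_mult})"
  by (simp add: psign_def)

lemma psign_transpose: "a \<noteq> b \<Longrightarrow> psign (transpose a b) * x = - (x :: 'a::{ring,monoid_mult})"
  by (simp add: psign_def evenperm_swap)

text \<open>The column determinant of the \<open>m\<close> by \<open>m\<close> matrix with entries
  \<open>X (r p) (c q)\<close>. Since selections may repeat or come in any order, permuting rows or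
  columns is composition with a permutation.\<close>

definition minor :: "nat \<Rightarrow> ('i \<Rightarrow> 'j \<Rightarrow> 'a::{ring,monoid_mult}) \<Rightarrow> (nat \<Rightarrow> 'i) \<Rightarrow> (nat \<Rightarrow> 'j) \<Rightarrow> 'a" where
  "minor m X r c =
     (\<Sum>\<sigma> | \<sigma> permutes {0..<m}. psign \<sigma> * prod_list (map (\<lambda>p. X (r (\<sigma> p)) (c p)) [0..<m]))"

lemma permutation_if_permutes: "\<sigma> permutes {0..<m::nat} \<Longrightarrow> permutation \<sigma>"
  using permutation_permutes by blast

lemma finite_permutes: "finite {\<sigma>. \<sigma> permutes {0..<m::nat}}"
  by (simp add: finite_permutations)

lemma minor_cong:
  assumes "\<And>p. p < m \<Longrightarrow> r p = r' p" "\<And>p. p < m \<Longrightarrow> c p = c' p"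
  shows "minor m X r c = minor m X r' c'"
  unfolding minor_def using assms
  by (intro sum.cong refl arg_cong2[where f="(*)"] arg_cong[where f=prod_list] map_cong)
    (auto dest: permutes_in_image)

text \<open>Permuting rows only relabels the summands by
  \<open>\<sigma> \<mapsto> \<tau> \<circ> \<sigma>\<close>; the factors stay in column order, so
  this holds over any ring.\<close>

lemma minor_row_permute:
  fixes X :: "'i \<Rightarrow> 'j \<Rightarrow> 'a::{ring,monoid_mult}"
  assumes "\<tau> permutes {0..<m}"
  shows "minor m X (r \<circ> \<tau>) c = psign \<tau> * minor m X r c"
proof -
  have "psign \<tau> * minor m X r c = (\<Sum>\<sigma> | \<sigma> permutes {0..<m}. psign \<tau> *
     (psign (\<tau> \<circ> \<sigma>) * prod_list (map (\<lambda>p. X (r ((\<tau> \<circ> \<sigma>) p)) (c p)) [0..<m])))"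
    unfolding minor_def sum_distrib_left by (rule setum_permutations_compose_left[OF assms])
  also have "\<dots> = minor m X (r \<circ> \<tau>) c"
    unfolding minor_def using assms
    by (intro sum.cong refl)
      (auto simp: psign_compose permutation_if_permutes mult.assoc psign_mult_self)
  finally show ?thesis ..
qed

lemma minor_commute:
  fixes A :: "'i \<Rightarrow> 'j \<Rightarrow> 'a::{ring,monoid_mult}"
  assumes "\<And>i j p q. A i j * B p q = B p q * A i j"
  shows "minor m A f g * minor m B f' g' = minor m B f' g' * minor m A f g"
proof -
  have "x * y = y * x" if "x = psign \<sigma> * prod_list (map (\<lambda>p. A (f (\<sigma> p)) (g p)) [0..<m])"
    "y = psign \<tau> * prod_list (map (\<lambda>p. B (f' (\<tau> p)) (g' p)) [0..<m])" for x y and \<sigma> \<tau> :: "nat \<Rightarrow> nat"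
  proof -
    have "prod_list (map (\<lambda>p. A (f (\<sigma> p)) (g p)) [0..<m]) * prod_list (map (\<lambda>p. B (f' (\<tau> p)) (g' p)) [0..<m])
      = prod_list (map (\<lambda>p. B (f' (\<tau> p)) (g' p)) [0..<m]) * prod_list (map (\<lambda>p. A (f (\<sigma> p)) (g p)) [0..<m])"
      using assms by (intro prod_list_commute) auto
    then show ?thesis using that by (simp add: psign_def)
  qed
  then show ?thesis
    unfolding minor_def sum_product by (subst (2) sum.swap) (intro sum.cong refl, blast)
qed

section \<open>Antisymmetry of minors under the Manin condition\<close>

text \<open>Stated on whole index types to avoid bounds; matrices enter extended by zero. For
  \<open>l = j\<close> it says that twice a commutator within a column vanishes, so over the complex
  numbers it includes commutation in columns.\<close>

definition manin_function :: "('i \<Rightarrow> 'j \<Rightarrow> 'a::ring) \<Rightarrow> bool" where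
  "manin_function X \<longleftrightarrow> (\<forall>i j k l. X i j * X k l - X k l * X i j = X k j * X i l - X i l * X k j)"

context complex_unital_algebra
begin

text \<open>Division by 2, available over the complex numbers; it turns antisymmetry into
  vanishing.\<close>

lemma eq_neg_self_imp_zero: "x = - x \<Longrightarrow> x = 0" for x :: 'a
proof -
  assume "x = - x"
  then have "scale (1 + 1) x = 0"
    by (metis scale_left_distrib scale_one add.right_inverse)
  then show "x = 0" by simp
qed

lemma sum_const_scale: "finite S \<Longrightarrow> (\<Sum>i\<in>S. x) = scale (of_nat (card S)) x"
  by (induction S rule: finite_induct) (simp_all add: scale_left_distrib)

text \<open>In the sum of the two minors, the terms of \<open>\<sigma>\<close> combine to
  \<open>L * (X a u * X b v + X a v * X b u) * R\<close>, because adjacent columns give neighbouring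
  factors. The Manin condition says exactly that the bracket is symmetric in \<open>a\<close> and
  \<open>b\<close>.\<close>

lemma minor_swap_adjacent_columns:
  fixes X :: "'i \<Rightarrow> 'j \<Rightarrow> 'a"
  assumes X: "manin_function X" and p: "Suc p < m"
  shows "minor m X r (c \<circ> transpose p (Suc p)) = - minor m X r c"
proof -
  define t where "t = transpose p (Suc p)"
  have t: "t permutes {0..<m}"
    unfolding t_def using p by (intro permutes_swap_id) auto
  define W where "W \<sigma> d = prod_list (map (\<lambda>q. X (r (\<sigma> q)) (d q)) [0..<m])" for \<sigma> d
  define Z where "Z \<sigma> = W \<sigma> c + W \<sigma> (c \<circ> t)" for \<sigma>
  have split: "[0..<m] = [0..<p] @ [p, Suc p] @ [Suc (Suc p)..<m]"
    using p upt_add_eq_append[of 0 p "m - p"] by (simp add: upt_conv_Cons)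
  have Z: "Z (\<sigma> \<circ> t) = Z \<sigma>" for \<sigma>
  proof -
    define L where "L = prod_list (map (\<lambda>q. X (r (\<sigma> q)) (c q)) [0..<p])"
    define R where "R = prod_list (map (\<lambda>q. X (r (\<sigma> q)) (c q)) [Suc (Suc p)..<m])"
    define a b where "a = r (\<sigma> p)" and "b = r (\<sigma> (Suc p))"
    define u v where "u = c p" and "v = c (Suc p)"
    have t_other: "t q = q" if "q < p \<or> q \<ge> Suc (Suc p)" for q
      using that by (auto simp: t_def transpose_def)
    \<comment> \<open>\<open>s\<close> and \<open>s'\<close> may exchange the two rows and the two
      columns; only the two middle factors react.\<close>
    have W: "W (\<sigma> \<circ> s) (c \<circ> s') = L * (X (r (\<sigma> (s p))) (c (s' p)) * X (r (\<sigma> (s (Suc p)))) (c (s' (Suc p)))) * R"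
      if "s = id \<or> s = t" "s' = id \<or> s' = t" for s s'
    proof -
      have "map (\<lambda>q. X (r ((\<sigma> \<circ> s) q)) ((c \<circ> s') q)) [0..<p] = map (\<lambda>q. X (r (\<sigma> q)) (c q)) [0..<p]"
        "map (\<lambda>q. X (r ((\<sigma> \<circ> s) q)) ((c \<circ> s') q)) [Suc (Suc p)..<m] = map (\<lambda>q. X (r (\<sigma> q)) (c q)) [Suc (Suc p)..<m]"
        using that by (auto simp: t_other)
      then show ?thesis
        unfolding W_def split map_append prod_list.append L_def R_def by (simp only:) (simp add: mult.assoc)
    qed
    have tp: "t p = Suc p" "t (Suc p) = p" by (simp_all add: t_def)
    have "X b u * X a v + X b v * X a u = X a u * X b v + X a v * X b u"
      using X[unfolded manin_function_def, rule_format, of a u b v] by (simp add: algebra_simps)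
    then show ?thesis
      using W[of id id] W[of id t] W[of t id] W[of t t]
      by (simp add: Z_def tp a_def b_def u_def v_def flip: distrib_left distrib_right)
  qed
  text \<open>By the Manin condition \<open>Z\<close> is invariant under \<open>\<sigma> \<mapsto> \<sigma> \<circ> t\<close>, while the sign changes.\<close>
  define Y where "Y = (\<Sum>\<sigma> | \<sigma> permutes {0..<m}. psign \<sigma> * Z \<sigma>)"
  have "Y = (\<Sum>\<sigma> | \<sigma> permutes {0..<m}. psign (\<sigma> \<circ> t) * Z (\<sigma> \<circ> t))"
    unfolding Y_def by (rule sum_permutations_compose_right[OF t])
  also have "\<dots> = - Y"
    unfolding Y_def Z sum_negf[symmetric]
  proof (intro sum.cong refl)
    fix \<sigma> assume "\<sigma> \<in> {\<sigma>. \<sigma> permutes {0..<m}}"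
    then have "psign (\<sigma> \<circ> t) * Z \<sigma> = psign \<sigma> * (psign t * Z \<sigma>)"
      using t by (simp add: psign_compose permutation_if_permutes mult.assoc)
    then show "psign (\<sigma> \<circ> t) * Z \<sigma> = - (psign \<sigma> * Z \<sigma>)"
      by (simp add: t_def psign_transpose)
  qed
  finally have "Y = 0" by (rule eq_neg_self_imp_zero)
  moreover have "Y = minor m X r c + minor m X r (c \<circ> t)"
    unfolding Y_def Z_def W_def minor_def by (simp add: distrib_left sum.distrib)
  ultimately show ?thesis
    unfolding t_def[symmetric] by (simp add: eq_neg_iff_add_eq_0 add.commute)
qed

text \<open>Induction on \<open>q\<close>: conjugating with an adjacent transposition moves
  \<open>q\<close> to \<open>Suc q\<close> and adds two sign changes.\<close>

lemma minor_swap_columns: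
  fixes X :: "'i \<Rightarrow> 'j \<Rightarrow> 'a"
  assumes X: "manin_function X" and "p < q" "q < m"
  shows "minor m X r (c \<circ> transpose p q) = - minor m X r c"
  using assms(2,3)
proof (induction q arbitrary: c)
  case (Suc q)
  show ?case
  proof (cases "p = q")
    case True
    then show ?thesis using minor_swap_adjacent_columns[OF X Suc.prems(2)] by (simp only:)
  next
    case False
    let ?s = "transpose q (Suc q)"
    have "transpose p (Suc q) = ?s \<circ> transpose p q \<circ> ?s"
      using False Suc.prems by (auto simp: fun_eq_iff transpose_def)
    then have "c \<circ> transpose p (Suc q) = ((c \<circ> ?s) \<circ> transpose p q) \<circ> ?s"
      by (simp add: o_assoc)
    then show ?thesis
      using False Suc by (simp only: minor_swap_adjacent_columns[OF X]) simp
  qed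
qed simp

text \<open>Unlike a row permutation, a column permutation reorders noncommuting factors, so the
  sign rule is built up from transpositions.\<close>

lemma minor_column_permute:
  fixes X :: "'i \<Rightarrow> 'j \<Rightarrow> 'a"
  assumes X: "manin_function X" and \<tau>: "\<tau> permutes {0..<m}"
  shows "minor m X r (c \<circ> \<tau>) = psign \<tau> * minor m X r c"
  using \<tau> finite_atLeastLessThan
proof (induction \<tau> arbitrary: c rule: permutes_induct)
  case id
  then show ?case by (simp add: psign_def)
next
  case (swap a b \<tau>)
  have "minor m X r (c \<circ> transpose a b) = - minor m X r c"
    using minor_swap_columns[OF X, of a b m r c] minor_swap_columns[OF X, of b a m r c] swap(1-3)
    by (cases "a < b") (auto simp: transpose_commute)
  then have "minor m X r (c \<circ> (transpose a b \<circ> \<tau>)) = psign \<tau> * - minor m X r c"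
    by (simp only: o_assoc swap.IH)
  also have "\<dots> = psign (transpose a b \<circ> \<tau>) * minor m X r c"
  proof -
    have "psign (transpose a b \<circ> \<tau>) = (psign (transpose a b) * psign \<tau> :: 'a)"
      using permutation_swap_id permutation_if_permutes[OF swap.hyps(4)] by (rule psign_compose)
    then show ?thesis by (simp add: psign_transpose[OF swap.hyps(3)])
  qed
  finally show ?case .
qed

text \<open>Exchanging two equal rows leaves the selection unchanged but flips the sign.\<close>

lemma minor_eq_0_if_repeated_row:
  fixes X :: "'i \<Rightarrow> 'j \<Rightarrow> 'a"
  assumes "\<not> inj_on r {0..<m}"
  shows "minor m X r c = 0"
proof -
  obtain p q where pq: "p < m" "q < m" "p \<noteq> q" "r p = r q"
    using assms by (auto simp: inj_on_def)
  have "r \<circ> transpose p q = r"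
    using pq by (auto simp: fun_eq_iff transpose_def)
  moreover have "transpose p q permutes {0..<m}"
    using pq by (intro permutes_swap_id) auto
  ultimately have "minor m X r c = - minor m X r c"
    using minor_row_permute[of "transpose p q" m X r c] pq by (simp add: psign_transpose)
  then show ?thesis by (rule eq_neg_self_imp_zero)
qed

section \<open>The Cauchy-Binet formula\<close>

text \<open>Expanding column \<open>p\<close> of the product chooses an index \<open>f p\<close>.
  The entries of \<open>B\<close> move right past those of \<open>A\<close>, leaving a minor of
  \<open>A\<close> times a single monomial of \<open>B\<close>. The factor \<open>fact m\<close>
  counts the orderings of each index set.\<close>

lemma Cauchy_Binet:
  fixes A :: "'i \<Rightarrow> 'l \<Rightarrow> 'a" and B :: "'l \<Rightarrow> 'j \<Rightarrow> 'a"
  assumes A: "manin_function A" and comm: "\<And>i j p q. A i j * B p q = B p q * A i j"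
    and S: "finite S"
  shows "scale (fact m) (minor m (\<lambda>i j. \<Sum>l\<in>S. A i l * B l j) r c) =
    (\<Sum>f\<in>{0..<m} \<rightarrow>\<^sub>E S. minor m A r f * minor m B f c)"
proof -
  let ?C = "\<lambda>i j. \<Sum>l\<in>S. A i l * B l j"
  let ?P = "{0..<m} \<rightarrow>\<^sub>E S" and ?G = "{\<sigma>. \<sigma> permutes {0..<m}}"
  define w where "w f = prod_list (map (\<lambda>p. B (f p) (c p)) [0..<m])" for f
  have expand: "minor m ?C r c = (\<Sum>f\<in>?P. minor m A r f * w f)"
  proof -
    have "minor m ?C r c = (\<Sum>\<sigma>\<in>?G. \<Sum>f\<in>?P. psign \<sigma> * prod_list (map (\<lambda>p. A (r (\<sigma> p)) (f p)) [0..<m]) * w f)"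
      unfolding minor_def w_def
    proof (intro sum.cong refl)
      fix \<sigma>
      have "prod_list (map (\<lambda>p. A (r (\<sigma> p)) (f p) * B (f p) (c p)) [0..<m]) =
        prod_list (map (\<lambda>p. A (r (\<sigma> p)) (f p)) [0..<m]) * prod_list (map (\<lambda>p. B (f p) (c p)) [0..<m])" for f
        by (rule prod_list_map_mult_commuting) (rule comm)
      then show "psign \<sigma> * prod_list (map (\<lambda>p. ?C (r (\<sigma> p)) (c p)) [0..<m]) =
        (\<Sum>f\<in>?P. psign \<sigma> * prod_list (map (\<lambda>p. A (r (\<sigma> p)) (f p)) [0..<m]) *
          prod_list (map (\<lambda>p. B (f p) (c p)) [0..<m]))"
        using prod_list_map_sum[of "[0..<m]" S "\<lambda>p l. A (r (\<sigma> p)) l * B l (c p)"] S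
        by (simp add: sum_distrib_left mult.assoc)
    qed
    then show ?thesis
      unfolding minor_def by (subst (asm) sum.swap) (simp add: sum_distrib_right)
  qed
  text \<open>Averaging this over \<open>\<tau>\<close> turns the monomial \<open>w f\<close> into a minor of \<open>B\<close>.\<close>
  have permuted: "minor m ?C r c = (\<Sum>f\<in>?P. minor m A r f * (psign \<tau> * w (f \<circ> \<tau>)))"
    if \<tau>: "\<tau> permutes {0..<m}" for \<tau>
  proof -
    \<comment> \<open>Extensionality survives because \<open>\<pi>\<close> fixes every point outside
      \<open>{0..<m}\<close>.\<close>
    have comp: "f \<circ> \<pi> \<in> ?P" if "f \<in> ?P" "\<pi> permutes {0..<m}" for f \<pi>
      using that permutes_in_image[OF that(2)] permutes_not_in[OF that(2)]
      by (auto simp: PiE_iff extensional_def)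
    have "bij_betw (\<lambda>f. f \<circ> \<tau>) ?P ?P"
      by (rule bij_betw_byWitness[where f'="\<lambda>f. f \<circ> inv_into UNIV \<tau>"])
        (use \<tau> comp permutes_inv[OF \<tau>] in \<open>auto simp: o_assoc[symmetric] permutes_inv_o[OF \<tau>]\<close>)
    then have "(\<Sum>f\<in>?P. minor m A r f * w f) = (\<Sum>f\<in>?P. minor m A r (f \<circ> \<tau>) * w (f \<circ> \<tau>))"
      by (rule sum.reindex_bij_betw[symmetric])
    then show ?thesis
      unfolding expand minor_column_permute[OF A \<tau>]
      by (simp add: mult.assoc[symmetric] psign_commute)
  qed
  have "scale (fact m) (minor m ?C r c) = (\<Sum>\<tau>\<in>?G. minor m ?C r c)"
    by (simp add: sum_const_scale finite_permutes card_permutations[of "{0..<m}" m])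
  also have "\<dots> = (\<Sum>\<tau>\<in>?G. \<Sum>f\<in>?P. minor m A r f * (psign \<tau> * w (f \<circ> \<tau>)))"
    by (intro sum.cong refl permuted) simp
  also have "\<dots> = (\<Sum>f\<in>?P. minor m A r f * minor m B f c)"
    by (subst sum.swap) (simp add: minor_def[of m B] w_def sum_distrib_left)
  finally show ?thesis .
qed


section \<open>Expansion of the determinant of the identity minus \<open>M\<close>\<close>

text \<open>The determinant on \<open>set js\<close> is the diagonal minor selected by
  \<open>(!) js\<close>. Each of the \<open>fact m\<close> injective selections is a reordering of
  \<open>js\<close>, and by \<open>M\<close> reordering does not change a diagonal minor.\<close>

lemma sum_minor_diagonal:
  fixes M :: "'i::linorder \<Rightarrow> 'i \<Rightarrow> 'a"
  assumes M: "\<And>f \<tau>. \<tau> permutes {0..<m} \<Longrightarrow> minor m M (f \<circ> \<tau>) (f \<circ> \<tau>) = minor m M f f"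
    and js: "distinct js" "length js = m"
  shows "scale (fact m) (\<Sum>\<sigma> | \<sigma> permutes set js. psign \<sigma> * prod_list (map (\<lambda>j. M (\<sigma> j) j) js)) =
    (\<Sum>f | f \<in> {0..<m} \<rightarrow>\<^sub>E set js \<and> inj_on f {0..<m}. minor m M f f)"
proof -
  have bij: "bij_betw ((!) js) {0..<m} (set js)"
    using js by (intro bij_betw_nth) (auto simp: atLeast0LessThan)
  have E: "(\<Sum>\<sigma> | \<sigma> permutes set js. psign \<sigma> * prod_list (map (\<lambda>j. M (\<sigma> j) j) js)) =
    minor m M ((!) js) ((!) js)"
  proof -
    \<comment> \<open>Conjugation with \<open>(!) js\<close> carries permutations of positions to
      permutations of entries and preserves parity.\<close>
    let ?h = "map_permutation {0..<m} ((!) js)"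
    have "?h = (\<lambda>\<sigma> x. if x \<in> set js then js ! \<sigma> (inv_into {0..<m} ((!) js) x) else x)"
      by (simp add: fun_eq_iff map_permutation_def restrict_id_def bij_betw_imp_surj_on[OF bij])
    then have "bij_betw ?h {\<sigma>. \<sigma> permutes {0..<m}} {\<sigma>. \<sigma> permutes set js}"
      using bij_betw_permutations[OF bij] by simp
    then have "(\<Sum>\<sigma> | \<sigma> permutes set js. psign \<sigma> * prod_list (map (\<lambda>j. M (\<sigma> j) j) js)) =
      (\<Sum>\<sigma> | \<sigma> permutes {0..<m}. psign (?h \<sigma>) * prod_list (map (\<lambda>j. M (?h \<sigma> j) j) js))"
      by (rule sum.reindex_bij_betw[symmetric])
    also have "\<dots> = minor m M ((!) js) ((!) js)"
      unfolding minor_def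
    proof (intro sum.cong refl)
      fix \<sigma> assume "\<sigma> \<in> {\<sigma>. \<sigma> permutes {0..<m}}"
      then have \<sigma>: "\<sigma> permutes {0..<m}" by simp
      have inj: "inj_on ((!) js) {0..<m}" using bij by (rule bij_betw_imp_inj_on)
      have "map (\<lambda>j. M (?h \<sigma> j) j) js = map (\<lambda>p. M (?h \<sigma> (js ! p)) (js ! p)) [0..<m]"
        using js(2) by (intro nth_equalityI) auto
      also have "\<dots> = map (\<lambda>p. M (js ! \<sigma> p) (js ! p)) [0..<m]"
        using inj \<sigma> by (intro map_cong refl) (auto simp: map_permutation_apply)
      finally show "psign (?h \<sigma>) * prod_list (map (\<lambda>j. M (?h \<sigma> j) j) js) =
        psign \<sigma> * prod_list (map (\<lambda>p. M (js ! \<sigma> p) (js ! p)) [0..<m])"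
        using evenperm_map_permutation[OF inj \<sigma>] by (simp add: psign_def)
    qed
    finally show ?thesis .
  qed
  let ?F = "{f \<in> {0..<m} \<rightarrow>\<^sub>E set js. inj_on f {0..<m}}"
  have diag: "minor m M f f = minor m M ((!) js) ((!) js)" if f: "f \<in> ?F" for f
  proof -
    have "f ` {0..<m} = set js"
      using f js by (intro card_subset_eq) (auto simp: card_image distinct_card)
    then have bf: "bij_betw f {0..<m} (set js)"
      using f by (auto simp: bij_betw_def)
    \<comment> \<open>\<open>\<tau> p\<close> is the position of \<open>f p\<close> in
      \<open>js\<close>, continued by the identity outside \<open>{0..<m}\<close>.\<close>
    define \<tau> where "\<tau> p = (if p \<in> {0..<m} then inv_into {0..<m} ((!) js) (f p) else p)" for p
    have "bij_betw \<tau> {0..<m} {0..<m}"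
      using bij_betw_trans[OF bf bij_betw_inv_into[OF bij]]
      by (rule bij_betw_cong[THEN iffD1, rotated]) (simp add: \<tau>_def)
    then have \<tau>: "\<tau> permutes {0..<m}"
      by (rule bij_imp_permutes) (simp add: \<tau>_def)
    have "((!) js \<circ> \<tau>) p = f p" if "p < m" for p
      using that bij_betw_inv_into_right[OF bij] bij_betwE[OF bf] by (simp add: \<tau>_def)
    then have "minor m M f f = minor m M ((!) js \<circ> \<tau>) ((!) js \<circ> \<tau>)"
      by (intro minor_cong) simp_all
    also have "\<dots> = minor m M ((!) js) ((!) js)"
      by (rule M[OF \<tau>])
    finally show ?thesis .
  qed
  have "card ?F = fact m"
    using card_inj_on_subset_funcset[of "{0..<m}" "set js" "{0..<m}"] js
    by (simp add: distinct_card fact_prod_rev)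
  moreover have "finite ?F"
    by (simp add: finite_PiE)
  moreover have "(\<Sum>f\<in>?F. minor m M f f) = (\<Sum>f\<in>?F. minor m M ((!) js) ((!) js))"
    by (rule sum.cong[OF refl diag])
  ultimately show ?thesis
    unfolding E by (simp only: sum_const_scale of_nat_fact)
qed

text \<open>\<open>I\<close> is the set of columns contributing \<open>- M\<close>. All other
  columns force \<open>\<sigma> j = j\<close>, so \<open>\<sigma>\<close> permutes \<open>I\<close>;
  its parity does not depend on the ambient set.\<close>

lemma det_delta_diff:
  fixes M :: "nat \<Rightarrow> nat \<Rightarrow> 'a"
  shows "(\<Sum>\<sigma> | \<sigma> permutes {0..<n}. psign \<sigma> *
      prod_list (map (\<lambda>j. (if \<sigma> j = j then 1 else 0) - M (\<sigma> j) j) [0..<n])) =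
    (\<Sum>I\<in>Pow {0..<n}. (- 1) ^ card I * (\<Sum>\<sigma> | \<sigma> permutes I.
      psign \<sigma> * prod_list (map (\<lambda>j. M (\<sigma> j) j) (filter (\<lambda>j. j \<in> I) [0..<n]))))"
proof -
  let ?G = "{\<sigma>. \<sigma> permutes {0..<n}}"
  let ?t = "\<lambda>I \<sigma>. (- 1) ^ card I * (psign \<sigma> *
     prod_list (map (\<lambda>j. M (\<sigma> j) j) (filter (\<lambda>j. j \<in> I) [0..<n])))"
  have comm: "psign \<sigma> * ((- 1) ^ k * x) = (- 1) ^ k * (psign \<sigma> * x)" for k and x :: 'a and \<sigma> :: "nat \<Rightarrow> nat"
    by (simp add: psign_def)
  have "(\<Sum>\<sigma>\<in>?G. psign \<sigma> * prod_list (map (\<lambda>j. (if \<sigma> j = j then 1 else 0) - M (\<sigma> j) j) [0..<n])) =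
    (\<Sum>\<sigma>\<in>?G. \<Sum>I\<in>Pow {0..<n}. if \<forall>j\<in>{0..<n} - I. \<sigma> j = j then ?t I \<sigma> else 0)"
    by (rule sum.cong[OF refl])
      (auto simp: prod_list_map_delta_diff sum_distrib_left comm intro!: sum.cong)
  also have "\<dots> = (\<Sum>I\<in>Pow {0..<n}. \<Sum>\<sigma>\<in>?G. if \<forall>j\<in>{0..<n} - I. \<sigma> j = j then ?t I \<sigma> else 0)"
    by (rule sum.swap)
  also have "\<dots> = (\<Sum>I\<in>Pow {0..<n}. \<Sum>\<sigma> | \<sigma> permutes I. ?t I \<sigma>)"
  proof (rule sum.cong[OF refl])
    fix I assume "I \<in> Pow {0..<n}"
    then have "{\<sigma>. \<sigma> permutes I} = {\<sigma> \<in> ?G. \<forall>j\<in>{0..<n} - I. \<sigma> j = j}"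
      by (auto intro: permutes_subset permutes_superset dest: permutes_not_in)
    then show "(\<Sum>\<sigma>\<in>?G. if \<forall>j\<in>{0..<n} - I. \<sigma> j = j then ?t I \<sigma> else 0) = (\<Sum>\<sigma> | \<sigma> permutes I. ?t I \<sigma>)"
      by (simp only: sum.inter_filter[OF finite_permutes])
  qed
  finally show ?thesis by (simp add: sum_distrib_left)
qed

text \<open>Subsets are grouped by size, and injective selections by their image. For
  \<open>m > n\<close> every selection repeats a row and contributes 0, so the bound
  \<open>N\<close> may exceed \<open>n\<close>; this lets determinants of different sizes share one
  range.\<close>

lemma det_delta_diff_eq_sum_minors:
  fixes M :: "nat \<Rightarrow> nat \<Rightarrow> 'a"
  assumes M: "\<And>m f \<tau>. \<tau> permutes {0..<m} \<Longrightarrow> minor m M (f \<circ> \<tau>) (f \<circ> \<tau>) = minor m M f f"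
    and N: "n \<le> N"
  shows "(\<Sum>\<sigma> | \<sigma> permutes {0..<n}. psign \<sigma> *
      prod_list (map (\<lambda>j. (if \<sigma> j = j then 1 else 0) - M (\<sigma> j) j) [0..<n])) =
    (\<Sum>m\<le>N. (- 1) ^ m * scale (1 / fact m) (\<Sum>f\<in>{0..<m} \<rightarrow>\<^sub>E {0..<n}. minor m M f f))"
proof -
  define E where "E I = (\<Sum>\<sigma> | \<sigma> permutes I.
      psign \<sigma> * prod_list (map (\<lambda>j. M (\<sigma> j) j) (filter (\<lambda>j. j \<in> I) [0..<n])))" for I
  let ?In = "\<lambda>m. {I \<in> Pow {0..<n}. card I = m}"
  have sum_E: "(\<Sum>I\<in>?In m. E I) = scale (1 / fact m) (\<Sum>f\<in>{0..<m} \<rightarrow>\<^sub>E {0..<n}. minor m M f f)" for m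
  proof -
    let ?inj = "\<lambda>I. {f \<in> {0..<m} \<rightarrow>\<^sub>E I. inj_on f {0..<m}}"
    have E: "scale (fact m) (E I) = (\<Sum>f\<in>?inj I. minor m M f f)" if I: "I \<in> ?In m" for I
    proof -
      have js: "set (filter (\<lambda>j. j \<in> I) [0..<n]) = I" using I by auto
      have dist: "distinct (filter (\<lambda>j. j \<in> I) [0..<n])" by simp
      have len: "length (filter (\<lambda>j. j \<in> I) [0..<n]) = m"
        using distinct_card[OF dist] js I by simp
      show ?thesis
        using sum_minor_diagonal[of m M, OF M dist len] unfolding E_def js by simp
    qed
    have fin: "finite (?inj {0..<n})" by (simp add: finite_PiE)
    \<comment> \<open>An injective map from \<open>m\<close> points into a set of size
      \<open>m\<close> is onto, so its image is all of \<open>I\<close>.\<close>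
    have fibre: "{f \<in> ?inj {0..<n}. f ` {0..<m} = I} = ?inj I" if I: "I \<in> ?In m" for I
    proof -
      have "finite I" using I by (auto intro: finite_subset)
      then have "f ` {0..<m} = I" if "f \<in> ?inj I" for f
        using that I by (intro card_subset_eq) (auto simp: card_image)
      then show ?thesis using I by (auto simp: PiE_iff)
    qed
    have "scale (fact m) (\<Sum>I\<in>?In m. E I) = (\<Sum>I\<in>?In m. \<Sum>f\<in>?inj I. minor m M f f)"
      unfolding scale_sum_right by (rule sum.cong[OF refl E])
    also have "\<dots> = (\<Sum>I\<in>?In m. \<Sum>f | f \<in> ?inj {0..<n} \<and> f ` {0..<m} = I. minor m M f f)"
      by (rule sum.cong[OF refl]) (simp only: fibre)
    also have "\<dots> = (\<Sum>f\<in>?inj {0..<n}. minor m M f f)"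
      by (rule sum.group[OF fin]) (auto simp: card_image PiE_iff)
    also have "\<dots> = (\<Sum>f\<in>{0..<m} \<rightarrow>\<^sub>E {0..<n}. minor m M f f)"
    proof (rule sum.mono_neutral_left)
      show "\<forall>f\<in>({0..<m} \<rightarrow>\<^sub>E {0..<n}) - ?inj {0..<n}. minor m M f f = 0"
        using minor_eq_0_if_repeated_row by blast
    qed (auto simp: finite_PiE)
    finally have "scale (fact m) (\<Sum>I\<in>?In m. E I) = (\<Sum>f\<in>{0..<m} \<rightarrow>\<^sub>E {0..<n}. minor m M f f)" .
    from arg_cong[OF this, of "scale (1 / fact m)"] show ?thesis by simp
  qed
  have "(\<Sum>I\<in>Pow {0..<n}. (- 1) ^ card I * E I) = (\<Sum>m\<le>N. \<Sum>I\<in>?In m. (- 1) ^ card I * E I)"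
  proof (rule sum.group[symmetric])
    show "card ` Pow {0..<n} \<subseteq> {..N}"
      using N by (auto dest: subset_eq_atLeast0_lessThan_card)
  qed auto
  also have "\<dots> = (\<Sum>m\<le>N. (- 1) ^ m * (\<Sum>I\<in>?In m. E I))"
    by (simp add: sum_distrib_left)
  finally show ?thesis
    unfolding det_delta_diff E_def[symmetric] sum_E .
qed

section \<open>Products of two Manin matrices\<close>

text \<open>The product is not assumed to be Manin, so its columns cannot be permuted directly.
  Cauchy-Binet passes the row permutation to \<open>A\<close> and the column permutation to
  \<open>B\<close>, and the two signs cancel.\<close>

lemma minor_product_diagonal_permute:
  fixes A :: "'i \<Rightarrow> 'l \<Rightarrow> 'a" and B :: "'l \<Rightarrow> 'i \<Rightarrow> 'a"
  assumes A: "manin_function A" and B: "manin_function B"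
    and comm: "\<And>i j p q. A i j * B p q = B p q * A i j"
    and S: "finite S" and \<tau>: "\<tau> permutes {0..<m}"
  shows "minor m (\<lambda>i j. \<Sum>l\<in>S. A i l * B l j) (f \<circ> \<tau>) (f \<circ> \<tau>) =
    minor m (\<lambda>i j. \<Sum>l\<in>S. A i l * B l j) f f" (is "minor m ?C _ _ = _")
proof -
  have "scale (fact m) (minor m ?C (f \<circ> \<tau>) (f \<circ> \<tau>)) = scale (fact m) (minor m ?C f f)"
    unfolding Cauchy_Binet[OF A comm S]
    unfolding minor_row_permute[OF \<tau>] minor_column_permute[OF B \<tau>]
    by (simp add: psign_def)
  then show ?thesis by simp
qed

text \<open>One factor \<open>1 / fact m\<close> corrects for the orderings \<open>f\<close> of a
  principal index set, the other for the orderings \<open>g\<close> in Cauchy-Binet.\<close>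

lemma det_delta_diff_product:
  fixes A B :: "nat \<Rightarrow> nat \<Rightarrow> 'a"
  assumes A: "manin_function A" and B: "manin_function B"
    and comm: "\<And>i j p q. A i j * B p q = B p q * A i j"
    and N: "n \<le> N"
  shows "(\<Sum>\<sigma> | \<sigma> permutes {0..<n}. psign \<sigma> * prod_list (map (\<lambda>j.
      (if \<sigma> j = j then 1 else 0) - (\<Sum>l\<in>{0..<k}. A (\<sigma> j) l * B l j)) [0..<n])) =
    (\<Sum>m\<le>N. (- 1) ^ m * scale (1 / fact m * (1 / fact m))
      (\<Sum>f\<in>{0..<m} \<rightarrow>\<^sub>E {0..<n}. \<Sum>g\<in>{0..<m} \<rightarrow>\<^sub>E {0..<k}. minor m A f g * minor m B g f))"
proof -
  let ?C = "\<lambda>i j. \<Sum>l\<in>{0..<k}. A i l * B l j"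
  have "minor m ?C f f = scale (1 / fact m) (\<Sum>g\<in>{0..<m} \<rightarrow>\<^sub>E {0..<k}. minor m A f g * minor m B g f)" for m f
    unfolding Cauchy_Binet[OF A comm finite_atLeastLessThan, symmetric] by simp
  then show ?thesis
    using det_delta_diff_eq_sum_minors[of ?C n N, OF minor_product_diagonal_permute[OF A B comm finite_atLeastLessThan] N]
    by (simp add: scale_sum_right[symmetric])
qed

end

section \<open>From matrices to functions, and the determinant identity\<close>

text \<open>Only entries within the index ranges enter, so \<open>A'\<close> and \<open>B'\<close>
  may be any extensions of the matrices.\<close>

lemma det_col_one_minus_mult:
  fixes A B :: "'a::{ring,monoid_mult} mat"
  assumes A: "A \<in> carrier_mat n k" and B: "B \<in> carrier_mat k n"
    and A': "\<And>i j. i < n \<Longrightarrow> j < k \<Longrightarrow> A' i j = A $$ (i, j)"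
    and B': "\<And>i j. i < k \<Longrightarrow> j < n \<Longrightarrow> B' i j = B $$ (i, j)"
  shows "det_col (1\<^sub>m n - A * B) = (\<Sum>\<sigma> | \<sigma> permutes {0..<n}. psign \<sigma> * prod_list (map (\<lambda>j.
      (if \<sigma> j = j then 1 else 0) - (\<Sum>l\<in>{0..<k}. A' (\<sigma> j) l * B' l j)) [0..<n]))"
proof -
  have "(1\<^sub>m n - A * B) $$ (\<sigma> j, j) = (if \<sigma> j = j then 1 else 0) - (\<Sum>l\<in>{0..<k}. A' (\<sigma> j) l * B' l j)"
    if "\<sigma> permutes {0..<n}" "j < n" for \<sigma> j
  proof -
    have "\<sigma> j < n" using permutes_in_image[OF that(1), of j] that(2) by simp
    then show ?thesis
      using that(2) A B by (auto simp: scalar_prod_def A' B')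
  qed
  then show ?thesis
    using A B unfolding det_col_def psign_def
    by (auto intro!: sum.cong arg_cong[where f=prod_list] arg_cong[where f=uminus])
qed

text \<open>Each product in the Manin relation involves all four indices, so both sides vanish as
  soon as one index is out of range.\<close>

lemma manin_function_extend_zero:
  assumes "manin_matrix A" "A \<in> carrier_mat n k"
  shows "manin_function (\<lambda>i j. if i < n \<and> j < k then A $$ (i, j) else 0)"
  using assms unfolding manin_matrix_def manin_function_def ring_commutator_def by auto

theorem proposition11:
  fixes scale :: "complex \<Rightarrow> 'a::{ring,monoid_mult} \<Rightarrow> 'a"
    and A B :: "'a mat"
    and n k :: nat
  assumes "complex_unital_algebra scale"
    and "A \<in> carrier_mat n k"
    and "B \<in> carrier_mat k n"
    and "manin_matrix A"
    and "manin_matrix B"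
    and "\<And>i j p q. i < n \<Longrightarrow> j < k \<Longrightarrow> p < k \<Longrightarrow> q < n \<Longrightarrow>
           ring_commutator (A $$ (i, j)) (B $$ (p, q)) = 0"
  shows "det_col (1\<^sub>m n - A * B) = det_col (1\<^sub>m k - B * A)"
proof -
  interpret complex_unital_algebra scale by fact
  define A' where "A' i j = (if i < n \<and> j < k then A $$ (i, j) else 0)" for i j
  define B' where "B' i j = (if i < k \<and> j < n then B $$ (i, j) else 0)" for i j
  have A': "manin_function A'" and B': "manin_function B'"
    unfolding A'_def B'_def using assms by (simp_all only: manin_function_extend_zero)
  have comm: "A' i j * B' p q = B' p q * A' i j" for i j p q
    using assms(6)[of i j p q] by (simp add: A'_def B'_def ring_commutator_def)
  have minors: "minor m A' f g * minor m B' g f = minor m B' g f * minor m A' f g" for m f g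
    by (rule minor_commute[OF comm])
  \<comment> \<open>A common range for both expansions, so that they can be compared term by
    term.\<close>
  let ?N = "max n k"
  have "det_col (1\<^sub>m n - A * B) = (\<Sum>m\<le>?N. (- 1) ^ m * scale (1 / fact m * (1 / fact m))
      (\<Sum>f\<in>{0..<m} \<rightarrow>\<^sub>E {0..<n}. \<Sum>g\<in>{0..<m} \<rightarrow>\<^sub>E {0..<k}. minor m A' f g * minor m B' g f))"
    unfolding det_delta_diff_product[OF A' B' comm max.cobounded1, symmetric]
    by (rule det_col_one_minus_mult[OF assms(2,3)]) (simp_all add: A'_def B'_def)
  \<comment> \<open>Minors of \<open>A'\<close> and \<open>B'\<close> commute, so exchanging the
    sums over \<open>f\<close> and \<open>g\<close> gives the expansion with the roles of the
    matrices reversed.\<close>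
  also have "\<dots> = (\<Sum>m\<le>?N. (- 1) ^ m * scale (1 / fact m * (1 / fact m))
      (\<Sum>g\<in>{0..<m} \<rightarrow>\<^sub>E {0..<k}. \<Sum>f\<in>{0..<m} \<rightarrow>\<^sub>E {0..<n}. minor m B' g f * minor m A' f g))"
    unfolding minors by (subst (2) sum.swap) (rule refl)
  also have "\<dots> = det_col (1\<^sub>m k - B * A)"
    unfolding det_delta_diff_product[OF B' A' comm[symmetric] max.cobounded2, symmetric]
    by (rule det_col_one_minus_mult[OF assms(3,2), symmetric]) (simp_all add: A'_def B'_def)
  finally show ?thesis .
qed

end
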